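(* Let $k\ge1$ be a fixed integer. For $n\ge0$ let $\overline{\mathrm{Kn}}(n,k)$ be the graph whose vertices are the ordered $k$-tuples of distinct elements of $[n]=\{1,\dots,n\}$, two tuples being adjacent when their underlying sets are disjoint. Then $\{\overline{\mathrm{Kn}}(n,k)\}_{n\ge0}$ is a two-level target sequence.
   Context: Graphs are finite and simple; $\hom(F,G)$ denotes the number of graph homomorphisms from $F$ to $G$. A sequence $\{G_q\}_{q\ge0}$ of graphs is strongly polynomial if for every fixed graph $F$ there is a polynomial $p_F$ with $\hom(F,G_q)=p_F(q)$ for all $q\ge0$. A numerical polynomial is $g\in\mathbb Q[x]$ with $g(q)\in\mathbb Z$ for all $q\in\mathbb Z$. Two-level polynomial: let $g$ be an eventually nonnegative numerical polynomial, $S=\{q\in\mathbb N: g(q)\ge0\}$, and $e:S\to\mathbb N\cup\{-1,\infty\}$. A sequence of polynomials $\{f_q(n)\}_{q\in S}$, with $f_q$ of degree $g(q)$, is a two-level polynomial of degree function $g$ and depth function $e$ if, writing $f_q(n)=\sum_{r=0}^\infty c_r(q)n^{g(q)-r}$ with $c_r(q)=0$ for $r>g(q)$, there exist polynomials $\{\varphi_r(q)\}_{r\ge0}$ such that $c_r(q)=\varphi_r(q)$ for every $q\in S$ and every $r\le e(q)$. For $q\in\mathbb N\setminus S$ one sets $f_q=0$, $e(q)=-1$. Infinite depth means $e(q)=\infty$ for all $q\in S$. A sequence of graphs $\{H_n\}_{n\ge0}$ is a two-level target sequence if for every strongly polynomial sequence $\{G_q\}_{q\ge0}$, $\hom(G_q,H_n)$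 is a two-level polynomial of infinite depth, i.e. there is a two-level polynomial $\{f_q(n)\}$ of infinite depth with $\hom(G_q,H_n)=f_q(n)$ for all $q,n\in\mathbb N$. *)

theory Defs
  imports
    "HOL-Computational_Algebra.Polynomial"
    "HOL-Library.Extended_Real"
    "HOL-Library.FuncSet"
    "Graph_Theory.Pair_Digraph"
begin

text \<open>
  Finite simple graphs are digraphs satisfying \<^locale>\<open>pair_graph\<close>: finite, loopless, with a
  symmetric arc set and no parallel arcs. An edge is therefore a pair of opposite arcs. The graph
  without vertices is allowed.
\<close>

definition homs :: "'a pair_pre_digraph \<Rightarrow> 'b pair_pre_digraph \<Rightarrow> ('a \<Rightarrow> 'b) set" where
  "homs F G = {h \<in> pverts F \<rightarrow>\<^sub>E pverts G. \<forall>(u, v) \<in> parcs F. (h u, h v) \<in> parcs G}"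

definition hom :: "'a pair_pre_digraph \<Rightarrow> 'b pair_pre_digraph \<Rightarrow> nat" where
  "hom F G = card (homs F G)"

text \<open>
  The quantified graphs below have natural numbers as vertices. Every finite graph is isomorphic to
  such a graph, so this is no restriction; see \<open>strongly_polynomial_any_type\<close> and
  \<open>two_level_target_any_type\<close> at the end of this theory.
\<close>

definition strongly_polynomial :: "(nat \<Rightarrow> 'a pair_pre_digraph) \<Rightarrow> bool" where
  "strongly_polynomial G \<longleftrightarrow>
     (\<forall>q. pair_graph (G q)) \<and>
     (\<forall>F :: nat pair_pre_digraph. pair_graph F \<longrightarrow>
        (\<exists>p :: rat poly. \<forall>q. of_nat (hom F (G q)) = poly p (of_nat q)))"

definition numerical_polynomial :: "rat poly \<Rightarrow> bool" where
  "numerical_polynomial g \<longleftrightarrow> (\<forall>q :: int. poly g (of_int q) \<in> \<int>)"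

definition nonneg_set :: "rat poly \<Rightarrow> nat set" where
  "nonneg_set g = {q. poly g (of_nat q) \<ge> 0}"

text \<open>
  \<open>top_coeff p r\<close> is \<open>c\<^sub>r\<close> in \<open>p(n) = (\<Sum>r. c\<^sub>r n\<^sup>d\<^sup>-\<^sup>r)\<close>, \<open>d = degree p\<close>.
\<close>

definition top_coeff :: "rat poly \<Rightarrow> nat \<Rightarrow> rat" where
  "top_coeff p r = (if r \<le> degree p then coeff p (degree p - r) else 0)"

text \<open>
  The depth function takes values in \<open>\<nat> \<union> {-1, \<infinity>}\<close>, represented inside \<^typ>\<open>ereal\<close>. Both \<open>f\<close> and
  \<open>e\<close> are total; outside \<open>nonneg_set g\<close> they have the conventional values \<open>0\<close> and \<open>-1\<close>. On
  \<open>nonneg_set g\<close> the condition \<open>f q \<noteq> 0\<close> is part of having degree \<open>g(q) \<ge> 0\<close>, since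
  \<^const>\<open>degree\<close> assigns \<open>0\<close> to the zero polynomial.
\<close>

definition two_level_polynomial ::
    "rat poly \<Rightarrow> (nat \<Rightarrow> ereal) \<Rightarrow> (nat \<Rightarrow> rat poly) \<Rightarrow> bool" where
  "two_level_polynomial g e f \<longleftrightarrow>
     numerical_polynomial g \<and>
     (\<forall>\<^sub>F q in sequentially. poly g (of_nat q) \<ge> 0) \<and>
     (\<forall>q \<in> nonneg_set g. e q \<in> insert (-1) (range ereal_of_enat)) \<and>
     (\<forall>q \<in> nonneg_set g. f q \<noteq> 0 \<and> of_nat (degree (f q)) = poly g (of_nat q)) \<and>
     (\<forall>q. q \<notin> nonneg_set g \<longrightarrow> f q = 0 \<and> e q = -1) \<and>
     (\<exists>\<phi> :: nat \<Rightarrow> rat poly. \<forall>q \<in> nonneg_set g. \<forall>r. ereal (real r) \<le> e q \<longrightarrow>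
        top_coeff (f q) r = poly (\<phi> r) (of_nat q))"

definition two_level_polynomial_infinite_depth :: "rat poly \<Rightarrow> (nat \<Rightarrow> rat poly) \<Rightarrow> bool" where
  "two_level_polynomial_infinite_depth g f \<longleftrightarrow>
     (\<exists>e. two_level_polynomial g e f \<and> (\<forall>q \<in> nonneg_set g. e q = \<infinity>))"

definition two_level_target :: "(nat \<Rightarrow> 'b pair_pre_digraph) \<Rightarrow> bool" where
  "two_level_target H \<longleftrightarrow>
     (\<forall>n. pair_graph (H n)) \<and>
     (\<forall>G :: nat \<Rightarrow> nat pair_pre_digraph. strongly_polynomial G \<longrightarrow>
        (\<exists>g f. two_level_polynomial_infinite_depth g f \<and>
           (\<forall>q n. of_nat (hom (G q) (H n)) = poly (f q) (of_nat n))))"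

text \<open>Ordered tuples are represented by lists.\<close>

definition kn_verts :: "nat \<Rightarrow> nat \<Rightarrow> nat list set" where
  "kn_verts n k = {xs. length xs = k \<and> distinct xs \<and> set xs \<subseteq> {1..n}}"

definition Kn_bar :: "nat \<Rightarrow> nat \<Rightarrow> nat list pair_pre_digraph" where
  "Kn_bar n k = \<lparr> pverts = kn_verts n k,
     parcs = {(xs, ys). xs \<in> kn_verts n k \<and> ys \<in> kn_verts n k \<and> set xs \<inter> set ys = {}} \<rparr>"


section \<open>Independence of the vertex type\<close>

definition image_graph :: "('a \<Rightarrow> 'b) \<Rightarrow> 'a pair_pre_digraph \<Rightarrow> 'b pair_pre_digraph" where
  "image_graph i G = \<lparr> pverts = i ` pverts G, parcs = map_prod i i ` parcs G \<rparr>"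

lemma image_graph_sel [simp]:
  "pverts (image_graph i G) = i ` pverts G"
  "parcs (image_graph i G) = map_prod i i ` parcs G"
  by (simp_all add: image_graph_def)

lemma pair_graph_arc_verts:
  assumes "pair_graph G" "(u, v) \<in> parcs G"
  shows "u \<in> pverts G" "v \<in> pverts G"
proof -
  interpret pair_graph G by fact
  show "u \<in> pverts G" "v \<in> pverts G"
    using assms(2) by (auto dest: wellformed')
qed

lemma pair_graph_image:
  assumes "pair_graph G" and inj: "inj_on i (pverts G)"
  shows "pair_graph (image_graph i G)"
proof -
  interpret pair_graph G by fact
  show ?thesis
  proof unfold_locales
    show "symmetric (image_graph i G)"
      using pair_sym_arcs
      by (fastforce simp: symmetric_def sym_def)
    fix e assume "e \<in> parcs (image_graph i G)"
    then obtain u v where uv: "(u, v) \<in> parcs G" "e = (i u, i v)" by auto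
    then show "fst e \<noteq> snd e"
      using inj_on_eq_iff[OF inj wellformed'[OF uv(1)]] pair_no_loops[OF uv(1)] by simp
  qed (auto dest: wellformed' simp: pair_finite_verts pair_finite_arcs)
qed

lemma homsI:
  assumes "\<And>u. u \<in> pverts F \<Longrightarrow> h u \<in> pverts G" "\<And>u. u \<notin> pverts F \<Longrightarrow> h u = undefined"
    "\<And>u v. (u, v) \<in> parcs F \<Longrightarrow> (h u, h v) \<in> parcs G"
  shows "h \<in> homs F G"
  using assms by (auto simp: homs_def PiE_def extensional_def)

lemma homsD:
  assumes "h \<in> homs F G"
  shows "u \<in> pverts F \<Longrightarrow> h u \<in> pverts G" "u \<notin> pverts F \<Longrightarrow> h u = undefined"
    "(u, v) \<in> parcs F \<Longrightarrow> (h u, h v) \<in> parcs G"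
  using assms by (auto simp: homs_def PiE_def extensional_def)

lemma hom_image_source:
  assumes G: "pair_graph G" and inj: "inj_on i (pverts G)"
  shows "hom (image_graph i G) H = hom G H"
proof -
  let ?j = "the_inv_into (pverts G) i"
  have j: "?j (i u) = u" if "u \<in> pverts G" for u
    using inj that by (rule the_inv_into_f_f)
  note arc = pair_graph_arc_verts[OF G]
  have "bij_betw (\<lambda>h. restrict (h \<circ> i) (pverts G)) (homs (image_graph i G) H) (homs G H)"
  proof (rule bij_betw_byWitness[where f' = "\<lambda>h. restrict (h \<circ> ?j) (i ` pverts G)"], safe)
    fix h assume h: "h \<in> homs (image_graph i G) H"
    show "restrict (restrict (h \<circ> i) (pverts G) \<circ> ?j) (i ` pverts G) = h"
      using homsD(2)[OF h] by (auto simp: fun_eq_iff restrict_def j)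
    show "restrict (h \<circ> i) (pverts G) \<in> homs G H"
    proof (rule homsI)
      fix u v assume uv: "(u, v) \<in> parcs G"
      then have "(i u, i v) \<in> parcs (image_graph i G)" by force
      then show "(restrict (h \<circ> i) (pverts G) u, restrict (h \<circ> i) (pverts G) v) \<in> parcs H"
        using homsD(3)[OF h] arc[OF uv] by simp
    qed (use homsD(1)[OF h] in auto)
  next
    fix h assume h: "h \<in> homs G H"
    show "restrict (restrict (h \<circ> ?j) (i ` pverts G) \<circ> i) (pverts G) = h"
      using homsD(2)[OF h] by (auto simp: fun_eq_iff restrict_def j)
    show "restrict (h \<circ> ?j) (i ` pverts G) \<in> homs (image_graph i G) H"
    proof (rule homsI)
      fix x y assume "(x, y) \<in> parcs (image_graph i G)"
      then obtain u v where uv: "(u, v) \<in> parcs G" "x = i u" "y = i v" by auto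
      then show "(restrict (h \<circ> ?j) (i ` pverts G) x, restrict (h \<circ> ?j) (i ` pverts G) y)
          \<in> parcs H"
        using homsD(3)[OF h uv(1)] arc[OF uv(1)] by (simp add: j)
    qed (use homsD(1)[OF h] in \<open>auto simp: j\<close>)
  qed
  then show ?thesis unfolding hom_def by (rule bij_betw_same_card)
qed

lemma hom_image_target:
  assumes F: "pair_graph F" and G: "pair_graph G" and inj: "inj_on i (pverts G)"
  shows "hom F (image_graph i G) = hom F G"
proof -
  let ?j = "the_inv_into (pverts G) i"
  have j: "?j (i u) = u" if "u \<in> pverts G" for u
    using inj that by (rule the_inv_into_f_f)
  note arcF = pair_graph_arc_verts[OF F] and arcG = pair_graph_arc_verts[OF G]
  have "bij_betw (\<lambda>h. restrict (i \<circ> h) (pverts F)) (homs F G) (homs F (image_graph i G))"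
  proof (rule bij_betw_byWitness[where f' = "\<lambda>h. restrict (?j \<circ> h) (pverts F)"], safe)
    fix h assume h: "h \<in> homs F G"
    show "restrict (?j \<circ> restrict (i \<circ> h) (pverts F)) (pverts F) = h"
      using homsD(1,2)[OF h] by (auto simp: fun_eq_iff restrict_def j)
    show "restrict (i \<circ> h) (pverts F) \<in> homs F (image_graph i G)"
    proof (rule homsI)
      fix u v assume uv: "(u, v) \<in> parcs F"
      have "(i (h u), i (h v)) \<in> parcs (image_graph i G)" using homsD(3)[OF h uv] by force
      then show "(restrict (i \<circ> h) (pverts F) u, restrict (i \<circ> h) (pverts F) v)
          \<in> parcs (image_graph i G)"
        using arcF[OF uv] by simp
    qed (use homsD(1)[OF h] in auto)
  next
    fix h assume h: "h \<in> homs F (image_graph i G)"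
    have j': "?j (h u) \<in> pverts G" "i (?j (h u)) = h u" if "u \<in> pverts F" for u
      using homsD(1)[OF h that] by (auto simp: j)
    show "restrict (i \<circ> restrict (?j \<circ> h) (pverts F)) (pverts F) = h"
      using homsD(2)[OF h] by (auto simp: fun_eq_iff restrict_def j')
    show "restrict (?j \<circ> h) (pverts F) \<in> homs F G"
    proof (rule homsI)
      fix u v assume uv: "(u, v) \<in> parcs F"
      then have "(?j (h u), ?j (h v)) \<in> parcs G"
        using homsD(3)[OF h uv] by (auto simp: j arcG)
      then show "(restrict (?j \<circ> h) (pverts F) u, restrict (?j \<circ> h) (pverts F) v) \<in> parcs G"
        using arcF[OF uv] by simp
    qed (simp_all add: j')
  qed
  then show ?thesis unfolding hom_def by (rule bij_betw_same_card[symmetric])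
qed

lemma ex_nat_embedding:
  assumes "pair_graph G"
  shows "\<exists>i :: 'a \<Rightarrow> nat. inj_on i (pverts (G :: 'a pair_pre_digraph))"
proof -
  interpret pair_graph G by fact
  show ?thesis using finite_imp_inj_to_nat_seg[OF pair_finite_verts] by blast
qed

lemma strongly_polynomial_any_type:
  fixes F :: "'c pair_pre_digraph"
  assumes "strongly_polynomial G" "pair_graph F"
  shows "\<exists>p :: rat poly. \<forall>q. of_nat (hom F (G q)) = poly p (of_nat q)"
proof -
  obtain i :: "'c \<Rightarrow> nat" where i: "inj_on i (pverts F)"
    using ex_nat_embedding[OF assms(2)] by blast
  show ?thesis
    using assms(1) pair_graph_image[OF assms(2) i] hom_image_source[OF assms(2) i]
    unfolding strongly_polynomial_def by metis
qed

lemma two_level_target_any_type: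
  fixes G :: "nat \<Rightarrow> 'a pair_pre_digraph"
  assumes H: "two_level_target H" and G: "strongly_polynomial G"
  shows "\<exists>g f. two_level_polynomial_infinite_depth g f \<and>
           (\<forall>q n. of_nat (hom (G q) (H n)) = poly (f q) (of_nat n))"
proof -
  have graph: "pair_graph (G q)" for q
    using G by (simp add: strongly_polynomial_def)
  obtain i :: "nat \<Rightarrow> 'a \<Rightarrow> nat" where i: "inj_on (i q) (pverts (G q))" for q
    using ex_nat_embedding[OF graph] by metis
  let ?G = "\<lambda>q. image_graph (i q) (G q)"
  have "strongly_polynomial ?G"
    using G pair_graph_image[OF graph i] hom_image_target[OF _ graph i]
    unfolding strongly_polynomial_def by (metis (no_types, lifting) ext)
  then have "\<exists>g f. two_level_polynomial_infinite_depth g f \<and>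
      (\<forall>q n. of_nat (hom (?G q) (H n)) = poly (f q) (of_nat n))"
    using H unfolding two_level_target_def by blast
  then show ?thesis
    by (simp add: hom_image_source[OF graph i])
qed

end

theory Submission
  imports Defs
begin

text \<open>
  A homomorphism into \<open>Kn_bar n k\<close> is a proper \<open>n\<close>-colouring of the lexicographic product
  \<open>L\<^sub>q = G\<^sub>q[K\<^sub>k]\<close>, so its count is the chromatic polynomial of \<open>L\<^sub>q\<close>, of degree
  \<open>k \<cdot> |V(G\<^sub>q)|\<close>. By Whitney's subset expansion its \<open>r\<close>-th coefficient from the top is the signed
  number of arc sets of rank \<open>r\<close>. Such a set touches at most \<open>2r\<close> vertices, so enumerating these
  vertices turns the coefficient into a combination, independent of \<open>q\<close>, of numbers of short
  vertex tuples of \<open>G\<^sub>q\<close> that satisfy prescribed adjacencies, equalities and their negations.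
  Moebius inversion removes the negations, and contracting the equalities leaves homomorphism
  counts, which are polynomial in \<open>q\<close>.
\<close>

section \<open>Subset expansion of the chromatic polynomial\<close>

definition rep :: "('a \<times> 'a) set \<Rightarrow> 'a \<Rightarrow> 'a" where
  "rep A v = (SOME u. (v, u) \<in> (A \<union> A\<inverse>)\<^sup>*)"

text \<open>
  For \<open>A \<subseteq> V \<times> V\<close> this is \<open>|V|\<close> minus the number of components of \<open>(V, A)\<close>, since vertices outside
  \<open>Field A\<close> represent themselves.
\<close>

definition rank :: "('a \<times> 'a) set \<Rightarrow> nat" where
  "rank A = card {v. rep A v \<noteq> v}"

lemma rep_rel: "(v, rep A v) \<in> (A \<union> A\<inverse>)\<^sup>*"
  unfolding rep_def by (rule someI) (rule rtrancl_refl)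

text \<open>Symmetry and transitivity make the predicates under \<open>SOME\<close> for
  \<open>u\<close> and \<open>v\<close> coincide, so the same element is chosen. The representative
  thus belongs to the component and not to the vertex.\<close>

lemma rep_cong:
  assumes "(u, v) \<in> (A \<union> A\<inverse>)\<^sup>*"
  shows "rep A u = rep A v"
proof -
  have "sym ((A \<union> A\<inverse>)\<^sup>*)" by (rule sym_rtrancl) (rule sym_Un_converse)
  then have "(v, u) \<in> (A \<union> A\<inverse>)\<^sup>*" using assms by (auto dest: symD)
  then have "(u, w) \<in> (A \<union> A\<inverse>)\<^sup>* \<longleftrightarrow> (v, w) \<in> (A \<union> A\<inverse>)\<^sup>*" for w
    using assms by (meson rtrancl_trans)
  then show ?thesis by (simp add: rep_def)
qed

lemma rep_arc: "(u, v) \<in> A \<Longrightarrow> rep A u = rep A v"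
  by (rule rep_cong) blast

lemma rep_rep [simp]: "rep A (rep A v) = rep A v"
  using rep_cong[OF rep_rel] by metis

text \<open>Constancy propagates along paths. With a truth-valued \<open>f\<close> this also
  controls membership (\<open>rep_in\<close>) and isolated vertices
  (\<open>rep_outside\<close>).\<close>

lemma fun_rep:
  assumes "\<forall>(u, v) \<in> A. f u = f v"
  shows "f (rep A v) = f v"
proof -
  have "f u = f v" if "(v, u) \<in> (A \<union> A\<inverse>)\<^sup>*" for u
    using that by (induction rule: rtrancl_induct) (use assms in auto)
  then show ?thesis using rep_rel by metis
qed

lemma rep_in: "A \<subseteq> V \<times> V \<Longrightarrow> rep A v \<in> V \<longleftrightarrow> v \<in> V"
  by (rule fun_rep) auto

lemma rep_outside: "v \<notin> Field A \<Longrightarrow> rep A v = v"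
proof -
  assume "v \<notin> Field A"
  then have "\<forall>(u, w) \<in> A. (v = u) = (v = w)" by (auto simp: Field_def)
  from fun_rep[OF this, of v] show ?thesis by simp
qed

lemma moved_subset: "A \<subseteq> V \<times> V \<Longrightarrow> {v. rep A v \<noteq> v} \<subseteq> V"
  using rep_outside[of _ A] by (auto simp: Field_def)

lemma rank_le: "A \<subseteq> V \<times> V \<Longrightarrow> finite V \<Longrightarrow> rank A \<le> card V"
  unfolding rank_def by (intro card_mono moved_subset)

lemma card_rep_image:
  assumes "A \<subseteq> V \<times> V" "finite V"
  shows "card (rep A ` V) = card V - rank A"
proof -
  \<comment> \<open>By \<open>rep_rep\<close> the image of \<open>rep A\<close> consists of its
    fixed points.\<close>
  have "rep A ` V = V - {v. rep A v \<noteq> v}"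
    using rep_in[OF assms(1)] by (auto intro: rev_image_eqI) 
  then show ?thesis
    using moved_subset[OF assms(1)] assms(2) 
    by (simp add: rank_def card_Diff_subset finite_subset)
qed

text \<open>A map constant on components is determined by its values at the representatives, which
  are arbitrary. This serves both to count colourings and, later, to contract prescribed
  equalities.\<close>

lemma bij_betw_constant_on_arcs:
  assumes "A \<subseteq> V \<times> V"
  shows "bij_betw (\<lambda>f. restrict f (rep A ` V)) {f \<in> V \<rightarrow>\<^sub>E C. \<forall>(u, v) \<in> A. f u = f v}
           (rep A ` V \<rightarrow>\<^sub>E C)"
proof (rule bij_betw_byWitness[where f' = "\<lambda>f. restrict (f \<circ> rep A) V"])
  let ?S = "{f \<in> V \<rightarrow>\<^sub>E C. \<forall>(u, v) \<in> A. f u = f v}"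
  show "\<forall>f\<in>?S. restrict (restrict f (rep A ` V) \<circ> rep A) V = f"
  proof
    fix f assume "f \<in> ?S"
    then have f: "f \<in> V \<rightarrow>\<^sub>E C" "\<forall>(u, v) \<in> A. f u = f v" by auto
    show "restrict (restrict f (rep A ` V) \<circ> rep A) V = f"
      using f(1) fun_rep[OF f(2)] by (auto simp: fun_eq_iff PiE_def extensional_def)
  qed
  show "(\<lambda>f. restrict f (rep A ` V)) ` ?S \<subseteq> rep A ` V \<rightarrow>\<^sub>E C"
    using rep_in[OF assms] by auto
  show "\<forall>f\<in>rep A ` V \<rightarrow>\<^sub>E C. restrict (restrict (f \<circ> rep A) V) (rep A ` V) = f"
    using rep_in[OF assms]
    by (auto simp: fun_eq_iff restrict_def PiE_def extensional_def)
  show "(\<lambda>f. restrict (f \<circ> rep A) V) ` (rep A ` V \<rightarrow>\<^sub>E C) \<subseteq> ?S"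
  proof (rule image_subsetI)
    fix f assume f: "f \<in> rep A ` V \<rightarrow>\<^sub>E C"
    have "restrict (f \<circ> rep A) V u = restrict (f \<circ> rep A) V v" if "(u, v) \<in> A" for u v
      using rep_arc[OF that] that assms by auto
    then show "restrict (f \<circ> rep A) V \<in> ?S" using f by auto
  qed
qed

lemma card_constant_on_arcs:
  assumes "A \<subseteq> V \<times> V" "finite V"
  shows "card {f \<in> V \<rightarrow>\<^sub>E C. \<forall>(u, v) \<in> A. f u = f v} = card C ^ (card V - rank A)"
  using bij_betw_same_card[OF bij_betw_constant_on_arcs[OF assms(1)]] assms
  by (simp add: card_PiE card_rep_image)

text \<open>\<open>rep\<close> rests on a choice and need not commute with \<open>y\<close>, so the
  ranks are compared through an invariant count: the maps into a two-element set that are constant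
  along arcs. Their number is a power of 2 whose exponent reveals the rank.\<close>

lemma rank_image:
  assumes "B \<subseteq> I \<times> I" "finite I" and inj: "inj_on y I"
  shows "rank (map_prod y y ` B) = rank B"
proof -
  let ?j = "the_inv_into I y" and ?C = "{..<2::nat}"
  let ?S = "\<lambda>V A. {f \<in> V \<rightarrow>\<^sub>E ?C. \<forall>(u, v) \<in> A. f u = f v}"
  have j: "?j (y i) = i" if "i \<in> I" for i
    using inj that by (rule the_inv_into_f_f)
  have sub: "map_prod y y ` B \<subseteq> y ` I \<times> y ` I" using assms(1) by auto
  have "bij_betw (\<lambda>f. restrict (f \<circ> y) I) (?S (y ` I) (map_prod y y ` B)) (?S I B)"
  proof (rule bij_betw_byWitness[where f' = "\<lambda>f. restrict (f \<circ> ?j) (y ` I)"])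
    show "\<forall>f\<in>?S (y ` I) (map_prod y y ` B). restrict (restrict (f \<circ> y) I \<circ> ?j) (y ` I) = f"
      by (auto simp: fun_eq_iff j PiE_def extensional_def)
    show "\<forall>f\<in>?S I B. restrict (restrict (f \<circ> ?j) (y ` I) \<circ> y) I = f"
      by (auto simp: fun_eq_iff j PiE_def extensional_def)
    show "(\<lambda>f. restrict (f \<circ> y) I) ` ?S (y ` I) (map_prod y y ` B) \<subseteq> ?S I B"
      using assms(1) by (auto simp: case_prod_map_prod)
    show "(\<lambda>f. restrict (f \<circ> ?j) (y ` I)) ` ?S I B \<subseteq> ?S (y ` I) (map_prod y y ` B)"
    proof (rule image_subsetI)
      fix f assume f: "f \<in> ?S I B"
      have "restrict (f \<circ> ?j) (y ` I) (y u) = restrict (f \<circ> ?j) (y ` I) (y v)"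
        if "(u, v) \<in> B" for u v
      proof -
        have "u \<in> I" "v \<in> I" using that assms(1) by auto
        moreover have "f u = f v" using that f by auto
        ultimately show ?thesis by (simp add: j)
      qed
      then show "restrict (f \<circ> ?j) (y ` I) \<in> ?S (y ` I) (map_prod y y ` B)"
        using f by (auto simp: j case_prod_map_prod)
    qed
  qed
  then have "card (?S (y ` I) (map_prod y y ` B)) = card (?S I B)" by (rule bij_betw_same_card)
  then have "(2::nat) ^ (card I - rank (map_prod y y ` B)) = 2 ^ (card I - rank B)"
    using card_constant_on_arcs[OF sub, of ?C] card_constant_on_arcs[OF assms(1,2), of ?C]
    by (simp add: assms(2) card_image[OF inj])
  then have "card I - rank (map_prod y y ` B) = card I - rank B" by simp
  \<comment> \<open>Subtraction is truncated, so equal differences give equal ranks only once both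
    ranks are known to be at most \<open>card I\<close>.\<close>
  moreover have "rank (map_prod y y ` B) \<le> card I"
    using rank_le[OF sub] assms(2) card_image[OF inj] by simp
  moreover have "rank B \<le> card I" using assms(1,2) by (rule rank_le)
  ultimately show ?thesis by linarith
qed

text \<open>Each vertex of \<open>Field A\<close> is moved by \<open>rep A\<close> or is the representative of a moved neighbour.\<close>

lemma card_Field_le:
  assumes "finite A" "irrefl A"
  shows "card (Field A) \<le> 2 * rank A"
proof -
  let ?M = "{v. rep A v \<noteq> v}"
  have fin: "finite ?M"
    using moved_subset[of A "Field A"] finite_Field[OF assms(1)]
    by (meson FieldI1 FieldI2 SigmaI finite_subset subrelI)
  have "Field A \<subseteq> ?M \<union> rep A ` ?M"
  proof
    fix v assume "v \<in> Field A"
    then obtain w where "(v, w) \<in> A \<or> (w, v) \<in> A" by (auto simp: Field_def)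
    then have w: "rep A v = rep A w" "w \<noteq> v"
      using assms(2) by (auto dest: rep_arc simp: irrefl_def)
    show "v \<in> ?M \<union> rep A ` ?M"
    proof (cases "rep A v = v")
      case True
      then have "v = rep A w" "w \<in> ?M" using w by auto
      then show ?thesis by blast
    qed simp
  qed
  then have "card (Field A) \<le> card (?M \<union> rep A ` ?M)"
    using fin by (intro card_mono) auto
  also have "\<dots> \<le> card ?M + card (rep A ` ?M)" by (rule card_Un_le)
  also have "\<dots> \<le> 2 * rank A" using card_image_le[OF fin, of "rep A"] by (simp add: rank_def)
  finally show ?thesis .
qed

lemma rank_eq_0_iff:
  assumes "finite A" "irrefl A"
  shows "rank A = 0 \<longleftrightarrow> A = {}"
proof
  assume "rank A = 0"
  then have "Field A = {}" using card_Field_le[OF assms] finite_Field[OF assms(1)] by simp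
  then show "A = {}" by (auto simp: Field_def)
qed (simp add: rank_def rep_outside)

text \<open>Whitney's expansion taken as a definition, over arcs instead of edges. For an edge made
  of two opposite arcs, the three nonempty choices have signs summing to -1, just as for a single
  edge, so symmetric arc sets need no special treatment.\<close>

definition chrom :: "'a set \<Rightarrow> ('a \<times> 'a) set \<Rightarrow> rat poly" where
  "chrom V R = (\<Sum>A\<in>Pow R. monom ((-1) ^ card A) (card V - rank A))"

text \<open>Inserting a fixed element \<open>x\<close> pairs the subsets with opposite
  signs.\<close>

lemma sum_Pow_sign:
  assumes "finite S"
  shows "(\<Sum>A\<in>Pow S. (-1) ^ card A) = (if S = {} then 1 else 0 :: 'b::comm_ring_1)"
  using assms
proof (induction)
  case (insert x F)
  have "(\<Sum>A\<in>Pow (insert x F). (-1) ^ card A)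
      = (\<Sum>A\<in>Pow F. (-1) ^ card A) + (\<Sum>A\<in>insert x ` Pow F. (-1) ^ card A :: 'b)"
    unfolding Pow_insert using insert by (intro sum.union_disjoint) auto
  also have "(\<Sum>A\<in>insert x ` Pow F. (-1) ^ card A) = (\<Sum>A\<in>Pow F. - ((-1) ^ card A) :: 'b)"
  proof (subst sum.reindex)
    show "inj_on (insert x) (Pow F)" using insert(2) unfolding inj_on_def by auto
    have "card (insert x A) = Suc (card A)" if "A \<subseteq> F" for A
      using that insert(1,2) by (intro card_insert_disjoint) (auto intro: finite_subset)
    then show "sum ((\<lambda>A. (-1) ^ card A) \<circ> insert x) (Pow F) = (\<Sum>A\<in>Pow F. - ((-1) ^ card A) :: 'b)"
      by (intro sum.cong) auto
  qed
  finally show ?case by (simp add: sum_negf)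
qed simp

text \<open>Inclusion-exclusion over the monochromatic arcs: after exchanging the sums, a map
  \<open>f\<close> contributes the signed number of subsets of its set \<open>?M f\<close> of
  monochromatic arcs, which is 0 unless that set is empty.\<close>

lemma poly_chrom:
  fixes V :: "'a set" and C :: "'c set"
  assumes "R \<subseteq> V \<times> V" "finite V" "finite C"
  shows "poly (chrom V R) (of_nat (card C)) =
           of_nat (card {f \<in> V \<rightarrow>\<^sub>E C. \<forall>(u, v) \<in> R. f u \<noteq> f v})"
proof -
  let ?F = "V \<rightarrow>\<^sub>E C" and ?M = "\<lambda>f. {(u, v) \<in> R. f u = f v}"
  have fin: "finite R" "finite ?F"
    using assms finite_subset by (auto intro: finite_PiE)
  have "poly (chrom V R) (of_nat (card C))
      = (\<Sum>A\<in>Pow R. (-1) ^ card A * of_nat (card C ^ (card V - rank A)))"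
    by (simp add: chrom_def poly_sum poly_monom)
  also have "\<dots> = (\<Sum>A\<in>Pow R. (-1) ^ card A * of_nat (card {f \<in> ?F. A \<subseteq> ?M f}))"
  proof (rule sum.cong)
    fix A assume A: "A \<in> Pow R"
    have "{f \<in> ?F. A \<subseteq> ?M f} = {f \<in> ?F. \<forall>(u, v) \<in> A. f u = f v}" using A by auto
    then show "(-1) ^ card A * of_nat (card C ^ (card V - rank A))
        = (-1) ^ card A * (of_nat (card {f \<in> ?F. A \<subseteq> ?M f}) :: rat)"
      using card_constant_on_arcs[of A V C] A assms by auto
  qed simp
  also have "\<dots> = (\<Sum>A\<in>Pow R. \<Sum>f\<in>?F. if A \<subseteq> ?M f then (-1) ^ card A else 0)"
    using fin by (intro sum.cong) (simp_all flip: sum.inter_filter)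
  also have "\<dots> = (\<Sum>f\<in>?F. \<Sum>A\<in>Pow R. if A \<subseteq> ?M f then (-1) ^ card A else 0)"
    by (rule sum.swap)
  also have "\<dots> = (\<Sum>f\<in>?F. if ?M f = {} then 1 else 0)"
  proof (rule sum.cong)
    fix f :: "'a \<Rightarrow> 'c"
    have "finite (?M f)" using fin(1) by (auto intro: finite_subset[rotated])
    moreover have "{A \<in> Pow R. A \<subseteq> ?M f} = Pow (?M f)" by auto
    ultimately show "(\<Sum>A\<in>Pow R. if A \<subseteq> ?M f then (-1) ^ card A else 0)
        = (if ?M f = {} then 1 else 0 :: rat)"
      using fin(1) by (simp only: sum.inter_filter[symmetric] finite_Pow_iff sum_Pow_sign)
  qed simp
  also have "\<dots> = of_nat (card {f \<in> ?F. ?M f = {}})"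
    using fin by (simp flip: sum.inter_filter)
  also have "{f \<in> ?F. ?M f = {}} = {f \<in> ?F. \<forall>(u, v) \<in> R. f u \<noteq> f v}" by auto
  finally show ?thesis .
qed

context
  fixes V :: "'a set" and R
  assumes R: "R \<subseteq> V \<times> V" and V: "finite V" and irr: "irrefl R"
begin

lemma finite_R: "finite R"
  using R V finite_subset by blast

lemma coeff_chrom:
  assumes "r \<le> card V"
  shows "coeff (chrom V R) (card V - r) = (\<Sum>A | A \<subseteq> R \<and> rank A = r. (-1) ^ card A)"
proof -
  have "coeff (chrom V R) (card V - r)
      = (\<Sum>A\<in>Pow R. if rank A = r then (-1) ^ card A else 0)"
    unfolding chrom_def coeff_sum
  proof (intro sum.cong)
    fix A assume "A \<in> Pow R"
    \<comment> \<open>Both truncated differences are exact here, so the exponents agree only for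
      \<open>rank A = r\<close>.\<close>
    then have "rank A \<le> card V" using R V by (intro rank_le) auto
    then show "coeff (monom ((-1) ^ card A) (card V - rank A)) (card V - r)
        = (if rank A = r then (-1) ^ card A else (0::rat))"
      using assms by auto
  qed simp
  also have "\<dots> = (\<Sum>A\<in>{A \<in> Pow R. rank A = r}. (-1) ^ card A)"
    using finite_R by (simp flip: sum.inter_filter)
  finally show ?thesis by simp
qed

text \<open>A loop would form a nonempty arc set of rank 0. Irreflexivity excludes this, and the
  empty set alone contributes.\<close>

lemma coeff_chrom_card: "coeff (chrom V R) (card V) = 1"
proof -
  have "rank A = 0 \<longleftrightarrow> A = {}" if "A \<subseteq> R" for A
    using irr finite_subset[OF that finite_R] that by (intro rank_eq_0_iff) (auto simp: irrefl_def)
  then have "{A. A \<subseteq> R \<and> rank A = 0} = {{}}" by auto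
  then show ?thesis using coeff_chrom[of 0] by simp
qed

lemma degree_chrom: "degree (chrom V R) = card V"
proof (rule antisym)
  show "degree (chrom V R) \<le> card V"
    unfolding chrom_def using finite_R
    by (intro degree_sum_le order_trans[OF degree_monom_le]) simp_all
  show "card V \<le> degree (chrom V R)"
    using coeff_chrom_card by (intro le_degree) simp
qed

text \<open>Beyond the degree both sides vanish: \<open>top_coeff\<close> by convention, the sum
  because no rank exceeds \<open>card V\<close>.\<close>

lemma top_coeff_chrom: "top_coeff (chrom V R) r = (\<Sum>A | A \<subseteq> R \<and> rank A = r. (-1) ^ card A)"
proof (cases "r \<le> card V")
  case False
  have "rank A \<le> card V" if "A \<subseteq> R" for A
    using that R V by (intro rank_le) auto
  with False have none: "{A. A \<subseteq> R \<and> rank A = r} = {}" by auto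
  show ?thesis unfolding none using False by (simp add: top_coeff_def degree_chrom)
qed (simp add: top_coeff_def degree_chrom coeff_chrom)

end

section \<open>Coefficients as counts of vertex tuples\<close>

text \<open>Reading off the values of an enumeration gives a repetition-free list of full length,
  and such lists are already counted in the library.\<close>

lemma card_enumerations:
  assumes "finite U"
  shows "card {y \<in> extensional {..<card U}. bij_betw y {..<card U} U} = fact (card U)"
proof -
  let ?m = "card U"
  let ?L = "{xs. length xs = ?m \<and> distinct xs \<and> set xs \<subseteq> U}"
  have "bij_betw (\<lambda>y. map y [0..<?m]) {y \<in> extensional {..<?m}. bij_betw y {..<?m} U} ?L"
  proof (rule bij_betw_byWitness[where f' = "\<lambda>xs. restrict ((!) xs) {..<?m}"])
    show "\<forall>y\<in>{y \<in> extensional {..<?m}. bij_betw y {..<?m} U}.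
        restrict ((!) (map y [0..<?m])) {..<?m} = y"
      by (auto simp: fun_eq_iff extensional_def)
    show "\<forall>xs\<in>?L. map (restrict ((!) xs) {..<?m}) [0..<?m] = xs"
      by (auto intro!: nth_equalityI)
    show "(\<lambda>y. map y [0..<?m]) ` {y \<in> extensional {..<?m}. bij_betw y {..<?m} U} \<subseteq> ?L"
      by (auto simp: bij_betw_def distinct_map atLeast0LessThan)
    show "(\<lambda>xs. restrict ((!) xs) {..<?m}) ` ?L \<subseteq> {y \<in> extensional {..<?m}. bij_betw y {..<?m} U}"
    proof (rule image_subsetI)
      fix xs assume xs: "xs \<in> ?L"
      then have "set xs = U"
        using assms by (intro card_subset_eq) (auto simp: distinct_card)
      then have "bij_betw ((!) xs) {..<?m} U"
        using xs by (intro bij_betw_nth) auto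
      then show "restrict ((!) xs) {..<?m} \<in> {y \<in> extensional {..<?m}. bij_betw y {..<?m} U}"
        using bij_betw_cong[of "{..<?m}" "restrict ((!) xs) {..<?m}" "(!) xs" U] by simp
    qed
  qed
  then have "card {y \<in> extensional {..<?m}. bij_betw y {..<?m} U} = card ?L"
    by (rule bij_betw_same_card)
  also have "\<dots> = fact ?m"
    using card_lists_distinct_length_eq[OF assms, of ?m] by (simp add: fact_prod)
  finally show ?thesis .
qed

lemma Field_map_prod_image: "Field (map_prod y y ` B) = y ` Field B"
  by (force simp: Field_def)

text \<open>
  A set of arcs that touches \<open>m\<close> vertices is the image of a set of arcs on \<open>{..<m}\<close> under
  exactly \<open>m!\<close> enumerations of these vertices.
\<close>

lemma sum_arc_sets_by_enumeration:
  assumes R: "R \<subseteq> V \<times> V" and V: "finite V"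
  shows "fact m * (\<Sum>A | A \<subseteq> R \<and> rank A = r \<and> card (Field A) = m. (-1) ^ card A) =
    (\<Sum>B | B \<subseteq> {..<m} \<times> {..<m} \<and> Field B = {..<m} \<and> rank B = r. (-1) ^ card B *
       of_nat (card {y \<in> {..<m} \<rightarrow>\<^sub>E V. inj_on y {..<m} \<and> map_prod y y ` B \<subseteq> R}) :: rat)"
proof -
  define AA where "AA = {A. A \<subseteq> R \<and> rank A = r \<and> card (Field A) = m}"
  define BB where "BB = {B. B \<subseteq> {..<m} \<times> {..<m} \<and> Field B = {..<m} \<and> rank B = r}"
  define En where "En U = {y \<in> extensional {..<m}. bij_betw y {..<m} U}" for U :: "'a set"
  define Em where "Em B = {y \<in> {..<m} \<rightarrow>\<^sub>E V. inj_on y {..<m} \<and> map_prod y y ` B \<subseteq> R}" for B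
  have "finite R" using R V finite_subset by blast
  have fin: "finite AA" "finite BB" "finite (Em B)" for B
  proof -
    show "finite AA" using \<open>finite R\<close> by (auto simp: AA_def)
    have "BB \<subseteq> Pow ({..<m} \<times> {..<m})" by (auto simp: BB_def)
    then show "finite BB" using finite_subset by blast
    show "finite (Em B)" unfolding Em_def using V by (auto intro!: finite_PiE)
  qed
  have FieldA: "finite (Field A)" "Field A \<subseteq> V" "card (Field A) = m" if "A \<in> AA" for A
  proof -
    have "finite A" using that finite_subset[OF _ \<open>finite R\<close>] by (auto simp: AA_def)
    then show "finite (Field A)" by (rule finite_Field)
  qed (use that R in \<open>auto simp: AA_def Field_def\<close>)
  have En: "card (En (Field A)) = fact m" "finite (En (Field A))" if "A \<in> AA" for A
  proof -
    show "card (En (Field A)) = fact m"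
      using card_enumerations[OF FieldA(1)[OF that]] FieldA(3)[OF that] by (simp add: En_def)
    \<comment> \<open>An infinite set has \<open>card\<close> 0, so the nonzero value
      \<open>fact m\<close> forces finiteness.\<close>
    then show "finite (En (Field A))" using card_ge_0_finite by force
  qed
  \<comment> \<open>\<open>pull A y\<close> transports \<open>A\<close> back to the indices. It will
    be inverse to taking the image under \<open>map_prod y y\<close>.\<close>
  define pull where "pull A y = {(i, j) \<in> {..<m} \<times> {..<m}. (y i, y j) \<in> A}"
    for A and y :: "nat \<Rightarrow> 'a"
  have pull: "map_prod y y ` pull A y = A" "pull A y \<in> BB" "y \<in> Em (pull A y)"
      "(-1) ^ card (pull A y) = ((-1) ^ card A :: rat)"
    if A: "A \<in> AA" and y: "y \<in> En (Field A)" for A y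
  proof -
    have inj: "inj_on y {..<m}" and ran: "y ` {..<m} = Field A"
      using y by (auto simp: En_def bij_betw_def)
    have "A \<subseteq> map_prod y y ` pull A y"
    proof (rule subrelI)
      fix u v assume uv: "(u, v) \<in> A"
      then have "u \<in> y ` {..<m}" "v \<in> y ` {..<m}" unfolding ran by (auto simp: Field_def)
      then obtain i j where "i < m" "j < m" "u = y i" "v = y j" by auto
      then show "(u, v) \<in> map_prod y y ` pull A y" using uv by (auto simp: pull_def intro!: image_eqI[of _ _ "(i, j)"])
    qed
    then show *: "map_prod y y ` pull A y = A" by (auto simp: pull_def)
    have "y ` Field (pull A y) = y ` {..<m}"
      using Field_map_prod_image[of y "pull A y"] ran * by simp
    moreover have "Field (pull A y) \<subseteq> {..<m}" by (auto simp: Field_def pull_def)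
    ultimately have F: "Field (pull A y) = {..<m}"
      using inj by (simp add: inj_on_image_eq_iff)
    have sub: "pull A y \<subseteq> {..<m} \<times> {..<m}" by (auto simp: pull_def)
    have "rank (pull A y) = rank A"
      using rank_image[OF sub _ inj] * by simp
    then show "pull A y \<in> BB" using F A by (auto simp: AA_def BB_def pull_def)
    show "y \<in> Em (pull A y)"
      using A y inj FieldA(2)[OF A] * by (auto simp: Em_def AA_def En_def bij_betw_def PiE_def)
    have "inj_on (map_prod y y) (pull A y)"
      using inj by (auto simp: inj_on_def pull_def)
    then show "(-1) ^ card (pull A y) = ((-1) ^ card A :: rat)"
      using card_image[of "map_prod y y" "pull A y"] * by simp
  qed
  have push: "pull (map_prod y y ` B) y = B" "map_prod y y ` B \<in> AA"
      "y \<in> En (Field (map_prod y y ` B))"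
    if B: "B \<in> BB" and y: "y \<in> Em B" for B y
  proof -
    have inj: "inj_on y {..<m}" using y by (auto simp: Em_def)
    have "(i, j) \<in> B" if "(u, v) \<in> B" "i < m" "j < m" "y i = y u" "y j = y v" for i j u v
    proof -
      have "u < m" "v < m" using that(1) B by (auto simp: BB_def)
      then show ?thesis using that inj by (auto dest: inj_onD)
    qed
    then show "pull (map_prod y y ` B) y = B"
      using B by (fastforce simp: BB_def pull_def)
    have F: "Field (map_prod y y ` B) = y ` {..<m}"
      using B by (simp add: Field_map_prod_image BB_def)
    have "rank (map_prod y y ` B) = rank B"
      using B inj by (intro rank_image[of _ "{..<m}"]) (auto simp: BB_def)
    then show "map_prod y y ` B \<in> AA"
      using B y inj F card_image[OF inj] by (auto simp: AA_def BB_def Em_def)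
    show "y \<in> En (Field (map_prod y y ` B))"
      using y F by (auto simp: En_def Em_def bij_betw_def PiE_def)
  qed
  have "fact m * (\<Sum>A\<in>AA. (-1) ^ card A) = (\<Sum>A\<in>AA. \<Sum>y\<in>En (Field A). (-1) ^ card A :: rat)"
    by (simp add: sum_distrib_left En)
  also have "\<dots> = (\<Sum>(A, y)\<in>Sigma AA (\<lambda>A. En (Field A)). (-1) ^ card A)"
    by (rule sum.Sigma) (use fin En in auto)
  \<comment> \<open>Double counting: the pairs of an arc set with an enumeration of its field
    correspond to the pairs of an index pattern with an embedding of it, and the sign is
    preserved.\<close>
  also have "\<dots> = (\<Sum>(B, y)\<in>Sigma BB Em. (-1) ^ card B)"
    by (rule sum.reindex_bij_witness[where
          i = "\<lambda>(B, y). (map_prod y y ` B, y)" and j = "\<lambda>(A, y). (pull A y, y)"]; clarify)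
      (simp_all add: pull push)
  also have "\<dots> = (\<Sum>B\<in>BB. (-1) ^ card B * of_nat (card (Em B)))"
    using fin by (simp add: mult.commute flip: sum.Sigma)
  finally show ?thesis by (simp add: AA_def BB_def Em_def)
qed

text \<open>Arc sets are grouped by the number \<open>m\<close> of vertices they touch, at most
  \<open>2 * r\<close> by \<open>card_Field_le\<close>. The ranges of \<open>m\<close> and
  \<open>B\<close> then depend on \<open>r\<close> alone; only the innermost counts involve
  \<open>V\<close> and \<open>R\<close>.\<close>

lemma top_coeff_chrom_enumeration:
  assumes R: "R \<subseteq> V \<times> V" and V: "finite V" and irr: "irrefl R"
  shows "top_coeff (chrom V R) r = (\<Sum>m\<le>2 * r. 1 / fact m *
    (\<Sum>B | B \<subseteq> {..<m} \<times> {..<m} \<and> Field B = {..<m} \<and> rank B = r. (-1) ^ card B *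
       of_nat (card {y \<in> {..<m} \<rightarrow>\<^sub>E V. inj_on y {..<m} \<and> map_prod y y ` B \<subseteq> R})))"
proof -
  let ?AA = "{A. A \<subseteq> R \<and> rank A = r}"
  have "finite R" using R V finite_subset by blast
  have "card (Field A) \<le> 2 * r" if "A \<in> ?AA" for A
    using card_Field_le[of A] that finite_subset[OF _ \<open>finite R\<close>] irr
    by (auto simp: irrefl_def)
  then have "(\<lambda>A. card (Field A)) ` ?AA \<subseteq> {..2 * r}" by auto
  then have "(\<Sum>m\<le>2 * r. \<Sum>A\<in>{A \<in> ?AA. card (Field A) = m}. (-1) ^ card A :: rat)
      = (\<Sum>A\<in>?AA. (-1) ^ card A)"
    using \<open>finite R\<close> by (intro sum.group) auto
  moreover have "(\<Sum>A\<in>{A \<in> ?AA. card (Field A) = m}. (-1) ^ card A :: rat) = 1 / fact m *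
    (\<Sum>B | B \<subseteq> {..<m} \<times> {..<m} \<and> Field B = {..<m} \<and> rank B = r. (-1) ^ card B *
       of_nat (card {y \<in> {..<m} \<rightarrow>\<^sub>E V. inj_on y {..<m} \<and> map_prod y y ` B \<subseteq> R}))" for m
    unfolding sum_arc_sets_by_enumeration[OF R V, symmetric] by (simp add: conj_assoc)
  ultimately show ?thesis
    by (simp add: top_coeff_chrom[OF R V irr])
qed

section \<open>Counting vertex tuples by pattern\<close>

definition polynomial_seq :: "(nat \<Rightarrow> rat) \<Rightarrow> bool" where
  "polynomial_seq s \<longleftrightarrow> (\<exists>p. \<forall>q. s q = poly p (of_nat q))"

lemma polynomial_seq_cmult:
  assumes "polynomial_seq s"
  shows "polynomial_seq (\<lambda>q. c * s q)"
proof -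
  obtain p where "\<forall>q. s q = poly p (of_nat q)"
    using assms by (auto simp: polynomial_seq_def)
  then have "\<forall>q. c * s q = poly (smult c p) (of_nat q)" by simp
  then show ?thesis unfolding polynomial_seq_def by blast
qed

lemma polynomial_seq_sum:
  assumes "\<And>i. i \<in> I \<Longrightarrow> polynomial_seq (s i)"
  shows "polynomial_seq (\<lambda>q. \<Sum>i\<in>I. s i q)"
proof -
  obtain p where "\<forall>i\<in>I. \<forall>q. s i q = poly (p i) (of_nat q)"
    using assms unfolding polynomial_seq_def by metis
  then have "\<forall>q. (\<Sum>i\<in>I. s i q) = poly (\<Sum>i\<in>I. p i) (of_nat q)"
    by (simp add: poly_sum)
  then show ?thesis unfolding polynomial_seq_def by blast
qed

lemma strongly_polynomial_hom:
  assumes "strongly_polynomial G" "pair_graph (F :: nat pair_pre_digraph)"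
  shows "polynomial_seq (\<lambda>q. of_nat (hom F (G q)))"
  using assms by (simp add: strongly_polynomial_def polynomial_seq_def)

text \<open>The tag \<open>True\<close> marks adjacency and \<open>False\<close> marks equality. As
  patterns are sets, demanding at least certain relations is an inclusion, the form needed for
  Moebius inversion.\<close>

definition pattern :: "'a pair_pre_digraph \<Rightarrow> 'i set \<Rightarrow> ('i \<Rightarrow> 'a) \<Rightarrow> (bool \<times> 'i \<times> 'i) set" where
  "pattern G I x =
     {(b, i, j). i \<in> I \<and> j \<in> I \<and> (if b then (x i, x j) \<in> parcs G else x i = x j)}"

lemma pattern_subset: "pattern G I x \<subseteq> UNIV \<times> I \<times> I"
  by (auto simp: pattern_def)

lemma bij_betw_Collect_transfer:
  assumes "bij_betw f S S'" "\<And>x. x \<in> S \<Longrightarrow> P x \<longleftrightarrow> Q (f x)"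
  shows "bij_betw f {x \<in> S. P x} {x \<in> S'. Q x}"
  using assms by (auto simp: bij_betw_def inj_on_def)

text \<open>Contracting the equalities of \<open>T\<close> leaves a graph \<open>F\<close> on
  representatives, and the tuples in question are the homomorphisms from \<open>F\<close> to
  \<open>G q\<close>. If some adjacency contracts to a loop, no tuple qualifies.\<close>

lemma polynomial_seq_card_superpatterns:
  fixes I :: "nat set"
  assumes G: "strongly_polynomial G" and I: "finite I" and T: "T \<subseteq> UNIV \<times> I \<times> I"
  shows "polynomial_seq (\<lambda>q. of_nat (card {x \<in> I \<rightarrow>\<^sub>E pverts (G q). T \<subseteq> pattern (G q) I x}))"
proof -
  define E where "E = {(i, j). (False, i, j) \<in> T}"
  define A where "A = {(rep E i, rep E j) | i j. (True, i, j) \<in> T}"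
  \<comment> \<open>Adding the converse makes \<open>F\<close> symmetric; since the arcs of
    \<open>G q\<close> are symmetric, it imposes no new condition on the tuples.\<close>
  define F where "F = \<lparr>pverts = rep E ` I, parcs = A \<union> A\<inverse>\<rparr>"
  have EI: "E \<subseteq> I \<times> I" and TI: "\<And>i j. (True, i, j) \<in> T \<Longrightarrow> i \<in> I \<and> j \<in> I"
    using T by (auto simp: E_def)
  have graph: "pair_graph (G q)" for q
    using G by (simp add: strongly_polynomial_def)
  have sym: "(v, u) \<in> parcs (G q)" if "(u, v) \<in> parcs (G q)" for u v q
  proof -
    interpret pair_graph "G q" by (rule graph)
    show ?thesis using pair_sym_arcs that by (auto simp: symmetric_def sym_def)
  qed
  have loopfree: "(u, u) \<notin> parcs (G q)" for u q
  proof -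
    interpret pair_graph "G q" by (rule graph)
    show ?thesis using pair_no_loops by fastforce
  qed
  have pat: "T \<subseteq> pattern (G q) I x \<longleftrightarrow>
      (\<forall>(i, j) \<in> E. x i = x j) \<and> (\<forall>(u, v) \<in> A. (x u, x v) \<in> parcs (G q))" for q x
  proof (cases "\<forall>(i, j) \<in> E. x i = x j")
    case True
    then have rep: "x (rep E i) = x i" for i by (rule fun_rep)
    have "(\<forall>(u, v) \<in> A. (x u, x v) \<in> parcs (G q)) \<longleftrightarrow>
        (\<forall>i j. (True, i, j) \<in> T \<longrightarrow> (x (rep E i), x (rep E j)) \<in> parcs (G q))"
      unfolding A_def by blast
    then have "(\<forall>(u, v) \<in> A. (x u, x v) \<in> parcs (G q)) \<longleftrightarrow>
        (\<forall>i j. (True, i, j) \<in> T \<longrightarrow> (x i, x j) \<in> parcs (G q))"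
      by (simp only: rep)
    moreover have "T \<subseteq> pattern (G q) I x \<longleftrightarrow> (\<forall>i j. (True, i, j) \<in> T \<longrightarrow> (x i, x j) \<in> parcs (G q)) \<and>
        (\<forall>i j. (False, i, j) \<in> T \<longrightarrow> x i = x j)"
    proof -
      have "T \<subseteq> pattern (G q) I x \<longleftrightarrow> (\<forall>b i j. (b, i, j) \<in> T \<longrightarrow> (b, i, j) \<in> pattern (G q) I x)"
        by auto
      also have "\<dots> \<longleftrightarrow> (\<forall>b i j. (b, i, j) \<in> T \<longrightarrow> (if b then (x i, x j) \<in> parcs (G q) else x i = x j))"
        using T by (auto simp: pattern_def)
      finally show ?thesis by (simp add: all_bool_eq conj_commute)
    qed
    ultimately show ?thesis using True by (auto simp: E_def)
  next
    case False
    then obtain i j where "(False, i, j) \<in> T" "x i \<noteq> x j" by (auto simp: E_def)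
    then have "\<not> T \<subseteq> pattern (G q) I x" by (auto simp: pattern_def)
    then show ?thesis using False by blast
  qed
  show ?thesis
  proof (cases "irrefl A")
    case True
    have "pair_graph F"
    proof unfold_locales
      show "finite (pverts F)" using I by (simp add: F_def)
      have "parcs F \<subseteq> rep E ` I \<times> rep E ` I" using TI by (auto simp: F_def A_def)
      then show "finite (parcs F)" using I finite_subset by blast
      show "symmetric F" by (auto simp: symmetric_def sym_def F_def)
      fix e assume e: "e \<in> parcs F"
      then show "fst e \<noteq> snd e" using True by (cases e) (auto simp: F_def irrefl_def)
      show "fst e \<in> pverts F" "snd e \<in> pverts F" using e TI by (auto simp: F_def A_def)
    qed
    have "card {x \<in> I \<rightarrow>\<^sub>E pverts (G q). T \<subseteq> pattern (G q) I x} = hom F (G q)" for q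
    proof -
      let ?S = "{x \<in> I \<rightarrow>\<^sub>E pverts (G q). \<forall>(i, j) \<in> E. x i = x j}"
      have "bij_betw (\<lambda>x. restrict x (rep E ` I))
          {x \<in> ?S. \<forall>(u, v) \<in> A. (x u, x v) \<in> parcs (G q)}
          {h \<in> rep E ` I \<rightarrow>\<^sub>E pverts (G q). \<forall>(u, v) \<in> parcs F. (h u, h v) \<in> parcs (G q)}"
      proof (rule bij_betw_Collect_transfer[OF bij_betw_constant_on_arcs[OF EI]])
        fix x
        have *: "u \<in> rep E ` I \<and> v \<in> rep E ` I" if "(u, v) \<in> A" for u v
          using that TI by (auto simp: A_def)
        show "(\<forall>(u, v) \<in> A. (x u, x v) \<in> parcs (G q)) \<longleftrightarrow> (\<forall>(u, v) \<in> parcs F.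
            (restrict x (rep E ` I) u, restrict x (rep E ` I) v) \<in> parcs (G q))"
        proof -
          have "(\<forall>(u, v) \<in> A. (x u, x v) \<in> parcs (G q)) \<longleftrightarrow>
              (\<forall>(u, v) \<in> parcs F. (x u, x v) \<in> parcs (G q))"
            using sym by (auto simp: F_def ball_Un)
          also have "\<dots> \<longleftrightarrow> (\<forall>(u, v) \<in> parcs F.
              (restrict x (rep E ` I) u, restrict x (rep E ` I) v) \<in> parcs (G q))"
            using * by (intro ball_cong) (auto simp: F_def)
          finally show ?thesis .
        qed
      qed
      moreover have "{x \<in> ?S. \<forall>(u, v) \<in> A. (x u, x v) \<in> parcs (G q)}
          = {x \<in> I \<rightarrow>\<^sub>E pverts (G q). T \<subseteq> pattern (G q) I x}"
        unfolding pat by blast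
      moreover have "homs F (G q) =
          {h \<in> rep E ` I \<rightarrow>\<^sub>E pverts (G q). \<forall>(u, v) \<in> parcs F. (h u, h v) \<in> parcs (G q)}"
        by (simp add: homs_def F_def)
      ultimately show ?thesis by (simp only: hom_def bij_betw_same_card)
    qed
    then show ?thesis using strongly_polynomial_hom[OF G \<open>pair_graph F\<close>] by simp
  next
    case False
    then obtain u where "(u, u) \<in> A" by (auto simp: irrefl_def)
    then have none: "{x \<in> I \<rightarrow>\<^sub>E pverts (G q). T \<subseteq> pattern (G q) I x} = {}" for q
      unfolding pat using loopfree by blast
    show ?thesis unfolding none polynomial_seq_def by (intro exI[of _ 0]) simp
  qed
qed

text \<open>
  By Moebius inversion every weight depending only on the pattern is a linear combination of the
  indicators of \<open>T \<subseteq> pattern G I x\<close>.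
\<close>

lemma polynomial_seq_sum_pattern:
  fixes I :: "nat set" and W :: "(bool \<times> nat \<times> nat) set \<Rightarrow> rat"
  assumes G: "strongly_polynomial G" and I: "finite I"
  shows "polynomial_seq (\<lambda>q. \<Sum>x\<in>I \<rightarrow>\<^sub>E pverts (G q). W (pattern (G q) I x))"
proof -
  \<comment> \<open>\<open>a\<close> is the Moebius transform of \<open>W\<close> on finite sets. It
    does not depend on \<open>q\<close>, so it supplies constant coefficients.\<close>
  define a where "a S = (-1) ^ card S * (\<Sum>T\<in>Pow S. (-1) ^ card T * W T)" for S
  let ?Z = "UNIV \<times> I \<times> I :: (bool \<times> nat \<times> nat) set"
  let ?X = "\<lambda>q. I \<rightarrow>\<^sub>E pverts (G q)"
  have Z: "finite ?Z" using I by simp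
  have W: "W S = (\<Sum>T\<in>Pow S. a T)" if "finite S" for S
    using inclusion_exclusion_symmetric[of "\<lambda>S. \<Sum>T\<in>Pow S. (-1) ^ card T * W T" W S] that
    by (simp add: a_def)
  have fin: "finite (?X q)" for q
  proof -
    have "pair_graph (G q)" using G by (simp add: strongly_polynomial_def)
    then interpret pair_graph "G q" .
    show ?thesis using I pair_finite_verts by (intro finite_PiE)
  qed
  have "(\<Sum>x\<in>?X q. W (pattern (G q) I x))
      = (\<Sum>T\<in>Pow ?Z. a T * of_nat (card {x \<in> ?X q. T \<subseteq> pattern (G q) I x}))" for q
  proof -
    have "(\<Sum>x\<in>?X q. W (pattern (G q) I x))
        = (\<Sum>x\<in>?X q. \<Sum>T\<in>Pow ?Z. if T \<subseteq> pattern (G q) I x then a T else 0)"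
    proof (intro sum.cong refl)
      fix x
      have "{T \<in> Pow ?Z. T \<subseteq> pattern (G q) I x} = Pow (pattern (G q) I x)"
        using pattern_subset[of "G q" I x] by auto
      moreover have "finite (pattern (G q) I x)"
        using pattern_subset Z by (rule finite_subset)
      ultimately show "W (pattern (G q) I x)
          = (\<Sum>T\<in>Pow ?Z. if T \<subseteq> pattern (G q) I x then a T else 0)"
        using Z by (simp only: sum.inter_filter[symmetric] finite_Pow_iff W)
    qed
    also have "\<dots> = (\<Sum>T\<in>Pow ?Z. \<Sum>x\<in>?X q. if T \<subseteq> pattern (G q) I x then a T else 0)"
      by (rule sum.swap)
    also have "\<dots> = (\<Sum>T\<in>Pow ?Z. a T * of_nat (card {x \<in> ?X q. T \<subseteq> pattern (G q) I x}))"
      using fin[of q] by (intro sum.cong) (simp_all add: mult.commute flip: sum.inter_filter)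
    finally show ?thesis .
  qed
  then show ?thesis
    by (simp only:) (intro polynomial_seq_sum polynomial_seq_cmult
        polynomial_seq_card_superpatterns[OF G I], simp)
qed

section \<open>Colourings of the lexicographic product\<close>

text \<open>The lexicographic product of \<open>G\<close> with a complete graph: every vertex
  becomes a clique of \<open>k\<close> copies, and every arc joins all copies of its ends.\<close>

definition lex_arcs :: "'a pair_pre_digraph \<Rightarrow> nat \<Rightarrow> (('a \<times> nat) \<times> ('a \<times> nat)) set" where
  "lex_arcs G k = {((u, i), (v, j)). u \<in> pverts G \<and> v \<in> pverts G \<and> i < k \<and> j < k \<and>
     ((u, v) \<in> parcs G \<or> u = v \<and> i \<noteq> j)}"

lemma lex_arcs_subset: "lex_arcs G k \<subseteq> (pverts G \<times> {..<k}) \<times> (pverts G \<times> {..<k})"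
  by (auto simp: lex_arcs_def)

lemma irrefl_lex_arcs:
  assumes "pair_graph G"
  shows "irrefl (lex_arcs G k)"
proof -
  interpret pair_graph G by fact
  show ?thesis using pair_no_loops by (fastforce simp: irrefl_def lex_arcs_def)
qed

lemma pair_graph_Kn_bar:
  assumes "k \<ge> 1"
  shows "pair_graph (Kn_bar n k)"
proof unfold_locales
  have "kn_verts n k \<subseteq> {xs. set xs \<subseteq> {1..n} \<and> length xs = k}" by (auto simp: kn_verts_def)
  then have "finite (kn_verts n k)" by (rule finite_subset) (simp add: finite_lists_length_eq)
  then show fin: "finite (pverts (Kn_bar n k))" by (simp add: Kn_bar_def)
  have "parcs (Kn_bar n k) \<subseteq> pverts (Kn_bar n k) \<times> pverts (Kn_bar n k)"
    by (auto simp: Kn_bar_def)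
  then show "finite (parcs (Kn_bar n k))"
    using fin finite_subset by blast
  show "symmetric (Kn_bar n k)"
    by (auto simp: symmetric_def sym_def Kn_bar_def)
  fix e assume e: "e \<in> parcs (Kn_bar n k)"
  then show "fst e \<in> pverts (Kn_bar n k)" "snd e \<in> pverts (Kn_bar n k)"
    by (auto simp: Kn_bar_def)
  obtain xs ys where "e = (xs, ys)" by (cases e)
  \<comment> \<open>As \<open>k\<close> is positive, a tuple has an entry and so is not disjoint
    from itself. For \<open>k = 0\<close> the empty tuple would carry a loop.\<close>
  then show "fst e \<noteq> snd e"
    using e assms by (auto simp: Kn_bar_def kn_verts_def)
qed

text \<open>The \<open>i\<close>-th entry of the tuple at \<open>v\<close> is the colour of
  \<open>(v, i)\<close>. Distinct entries mean a proper colouring of the clique over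
  \<open>v\<close>; disjoint tuples mean a proper colouring between the cliques of adjacent
  vertices.\<close>

lemma hom_Kn_bar:
  assumes "pair_graph G"
  shows "hom G (Kn_bar n k) = card {f \<in> pverts G \<times> {..<k} \<rightarrow>\<^sub>E {1..n}. \<forall>(a, b) \<in> lex_arcs G k. f a \<noteq> f b}"
    (is "_ = card ?P")
proof -
  let ?V = "pverts G"
  define un where "un h = restrict (\<lambda>(v, i). h v ! i) (?V \<times> {..<k})" for h :: "'a \<Rightarrow> nat list"
  define tup where "tup f = restrict (\<lambda>v. map (\<lambda>i. f (v, i)) [0..<k]) ?V" for f :: "'a \<times> nat \<Rightarrow> nat"
  have vert: "h v \<in> kn_verts n k" if "h \<in> homs G (Kn_bar n k)" "v \<in> ?V" for h v
    using homsD(1)[OF that] by (simp add: Kn_bar_def)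
  note arc = pair_graph_arc_verts[OF assms]
  have "bij_betw un (homs G (Kn_bar n k)) ?P"
  proof (rule bij_betw_byWitness[where f' = tup])
    show "\<forall>h\<in>homs G (Kn_bar n k). tup (un h) = h"
    proof
      fix h assume h: "h \<in> homs G (Kn_bar n k)"
      have "tup (un h) v = h v" for v
      proof (cases "v \<in> ?V")
        case True
        then show ?thesis
          using vert[OF h True] by (auto simp: tup_def un_def kn_verts_def intro!: nth_equalityI)
      next
        case False
        then show ?thesis using homsD(2)[OF h False] by (simp add: tup_def)
      qed
      then show "tup (un h) = h" ..
    qed
    show "\<forall>f\<in>?P. un (tup f) = f"
      by (auto simp: fun_eq_iff un_def tup_def PiE_def extensional_def)
    show "un ` homs G (Kn_bar n k) \<subseteq> ?P"
    proof (rule image_subsetI)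
      fix h assume h: "h \<in> homs G (Kn_bar n k)"
      have "un h (v, i) \<in> {1..n}" if "v \<in> ?V" "i < k" for v i
      proof -
        have "h v ! i \<in> set (h v)" "set (h v) \<subseteq> {1..n}"
          using vert[OF h that(1)] that(2) by (simp_all add: kn_verts_def)
        then have "h v ! i \<in> {1..n}" by blast
        then show ?thesis using that by (simp add: un_def)
      qed
      moreover have "un h (u, i) \<noteq> un h (v, j)" if "((u, i), (v, j)) \<in> lex_arcs G k" for u i v j
      proof -
        have V: "u \<in> ?V" "v \<in> ?V" "i < k" "j < k" using that by (auto simp: lex_arcs_def)
        show ?thesis
        proof (cases "(u, v) \<in> parcs G")
          case True
          have "h u ! i \<in> set (h u)" "h v ! j \<in> set (h v)"
            using vert[OF h] V by (auto simp: kn_verts_def)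
          moreover have "set (h u) \<inter> set (h v) = {}"
            using homsD(3)[OF h True] by (simp add: Kn_bar_def)
          ultimately show ?thesis using V by (auto simp: un_def)
        next
          case False
          then have "u = v" "i \<noteq> j" using that by (auto simp: lex_arcs_def)
          then show ?thesis
            using vert[OF h V(1)] V by (simp add: un_def kn_verts_def nth_eq_iff_index_eq)
        qed
      qed
      moreover have "un h \<in> extensional (?V \<times> {..<k})" by (simp add: un_def)
      ultimately show "un h \<in> ?P" by (auto simp: PiE_def)
    qed
    show "tup ` ?P \<subseteq> homs G (Kn_bar n k)"
    proof (rule image_subsetI)
      fix f assume "f \<in> ?P"
      then have f: "\<And>v i. v \<in> ?V \<Longrightarrow> i < k \<Longrightarrow> f (v, i) \<in> {1..n}"
        "\<And>u i v j. ((u, i), (v, j)) \<in> lex_arcs G k \<Longrightarrow> f (u, i) \<noteq> f (v, j)"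
        by auto
      have kn: "tup f v \<in> kn_verts n k" if "v \<in> ?V" for v
      proof -
        have ij: "i = j" if "i < k" "j < k" "f (v, i) = f (v, j)" for i j
        proof (rule ccontr)
          assume "i \<noteq> j"
          then have "((v, i), (v, j)) \<in> lex_arcs G k"
            using \<open>v \<in> ?V\<close> that by (simp add: lex_arcs_def)
          from f(2)[OF this] that(3) show False by blast
        qed
        have "inj_on (\<lambda>i. f (v, i)) {0..<k}" by (rule inj_onI, rule ij) simp_all
        moreover have "tup f v = map (\<lambda>i. f (v, i)) [0..<k]" using that by (simp add: tup_def)
        ultimately show ?thesis
          using f(1)[OF that] by (simp add: kn_verts_def distinct_map image_subset_iff)
      qed
      show "tup f \<in> homs G (Kn_bar n k)"
      proof (rule homsI)
        fix u v assume uv: "(u, v) \<in> parcs G"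
        have "((u, i), (v, j)) \<in> lex_arcs G k" if "i < k" "j < k" for i j
          using uv arc[OF uv] that by (simp add: lex_arcs_def)
        then have "f (u, i) \<noteq> f (v, j)" if "i < k" "j < k" for i j
          using f(2) that by blast
        then have "set (tup f u) \<inter> set (tup f v) = {}"
          using arc[OF uv] by (auto simp: tup_def)
        then show "(tup f u, tup f v) \<in> parcs (Kn_bar n k)"
          using kn arc[OF uv] by (simp add: Kn_bar_def)
      qed (use kn in \<open>auto simp: Kn_bar_def tup_def\<close>)
    qed
  qed
  then show ?thesis unfolding hom_def by (rule bij_betw_same_card)
qed

text \<open>The second components come first in the pair, so that the later double sum has the copy
  indices outside and the vertex tuples inside.\<close>

lemma bij_betw_PiE_Times:
  "bij_betw (\<lambda>(g, f). restrict (\<lambda>i. (f i, g i)) I) ((I \<rightarrow>\<^sub>E B) \<times> (I \<rightarrow>\<^sub>E A)) (I \<rightarrow>\<^sub>E A \<times> B)"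
proof (rule bij_betw_byWitness[where
      f' = "\<lambda>y. (restrict (snd \<circ> y) I, restrict (fst \<circ> y) I)"])
  have "restrict (\<lambda>i. (restrict (fst \<circ> y) I i, restrict (snd \<circ> y) I i)) I = y"
    if "y \<in> extensional I" for y :: "'a \<Rightarrow> 'c \<times> 'b"
    using that by (intro extensionalityI[of _ I]) auto
  then show "\<forall>y\<in>I \<rightarrow>\<^sub>E A \<times> B. (case (restrict (snd \<circ> y) I, restrict (fst \<circ> y) I) of
      (g, f) \<Rightarrow> restrict (\<lambda>i. (f i, g i)) I) = y"
    by (simp add: PiE_def)
  have "restrict (snd \<circ> restrict (\<lambda>i. (f i, g i)) I) I = g"
       "restrict (fst \<circ> restrict (\<lambda>i. (f i, g i)) I) I = f"
    if "g \<in> extensional I" "f \<in> extensional I" for g :: "'a \<Rightarrow> 'b" and f :: "'a \<Rightarrow> 'c"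
    using that by (auto intro!: extensionalityI[of _ I])
  then show "\<forall>z\<in>(I \<rightarrow>\<^sub>E B) \<times> (I \<rightarrow>\<^sub>E A).
      (\<lambda>y. (restrict (snd \<circ> y) I, restrict (fst \<circ> y) I))
        (case z of (g, f) \<Rightarrow> restrict (\<lambda>i. (f i, g i)) I) = z"
    by (auto simp: PiE_def)
  show "(\<lambda>(g, f). restrict (\<lambda>i. (f i, g i)) I) ` ((I \<rightarrow>\<^sub>E B) \<times> (I \<rightarrow>\<^sub>E A)) \<subseteq> I \<rightarrow>\<^sub>E A \<times> B"
    by auto
  show "(\<lambda>y. (restrict (snd \<circ> y) I, restrict (fst \<circ> y) I)) ` (I \<rightarrow>\<^sub>E A \<times> B)
      \<subseteq> (I \<rightarrow>\<^sub>E B) \<times> (I \<rightarrow>\<^sub>E A)"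
    by (rule image_subsetI) (simp add: PiE_def Pi_def mem_Times_iff)
qed

text \<open>A tuple \<open>y\<close> splits into vertices \<open>x\<close> and copy indices
  \<open>b\<close>. For fixed \<open>b\<close>, injectivity and the arc conditions depend only on
  which entries of \<open>x\<close> are equal or adjacent, so \<open>W b\<close> is an indicator on
  patterns.\<close>

lemma card_lex_embeddings:
  fixes k m :: nat
  assumes G: "pair_graph G" and B: "B \<subseteq> {..<m} \<times> {..<m}"
  defines "W \<equiv> \<lambda>b P. if (\<forall>i<m. \<forall>j<m. (False, i, j) \<in> P \<and> b i = b j \<longrightarrow> i = j) \<and>
     (\<forall>(i, j)\<in>B. (True, i, j) \<in> P \<or> (False, i, j) \<in> P \<and> b i \<noteq> b j) then 1 else 0"
  shows "of_nat (card {y \<in> {..<m} \<rightarrow>\<^sub>E pverts G \<times> {..<k}.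
      inj_on y {..<m} \<and> map_prod y y ` B \<subseteq> lex_arcs G k}) =
    (\<Sum>b\<in>{..<m} \<rightarrow>\<^sub>E {..<k}. \<Sum>x\<in>{..<m} \<rightarrow>\<^sub>E pverts G. W b (pattern G {..<m} x) :: rat)"
proof -
  let ?b = "{..<m} \<rightarrow>\<^sub>E {..<k}" and ?x = "{..<m} \<rightarrow>\<^sub>E pverts G"
  let ?y = "{..<m} \<rightarrow>\<^sub>E pverts G \<times> {..<k}"
  interpret pair_graph G by fact
  have fin: "finite ?b" "finite ?x" using pair_finite_verts by (auto intro: finite_PiE)
  define Q where "Q y \<longleftrightarrow> inj_on y {..<m} \<and> map_prod y y ` B \<subseteq> lex_arcs G k" for y
  define P where "P b x \<longleftrightarrow> W b (pattern G {..<m} x) = 1" for b x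
  define pr where "pr b x = restrict (\<lambda>i. (x i, b i)) {..<m}" for b :: "nat \<Rightarrow> nat" and x :: "nat \<Rightarrow> 'a"
  have PQ: "P b x \<longleftrightarrow> Q (pr b x)" if b: "b \<in> ?b" and x: "x \<in> ?x" for b x
  proof -
    have V: "x i \<in> pverts G" "b i < k" if "i < m" for i
      using PiE_mem[OF b, of i] PiE_mem[OF x, of i] that by simp_all
    have pat: "(False, i, j) \<in> pattern G {..<m} x \<longleftrightarrow> x i = x j"
        "(True, i, j) \<in> pattern G {..<m} x \<longleftrightarrow> (x i, x j) \<in> parcs G" if "i < m" "j < m" for i j
      using that by (auto simp: pattern_def)
    have Bm: "i < m" "j < m" if "(i, j) \<in> B" for i j using subsetD[OF B that] by simp_all
    have "inj_on (pr b x) {..<m} \<longleftrightarrow>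
        (\<forall>i<m. \<forall>j<m. (False, i, j) \<in> pattern G {..<m} x \<and> b i = b j \<longrightarrow> i = j)"
      unfolding inj_on_def by (simp add: Ball_def pr_def pat)
    moreover have "map_prod (pr b x) (pr b x) ` B \<subseteq> lex_arcs G k \<longleftrightarrow>
        (\<forall>(i, j)\<in>B. (pr b x i, pr b x j) \<in> lex_arcs G k)"
      by auto
    moreover have "(\<forall>(i, j)\<in>B. (pr b x i, pr b x j) \<in> lex_arcs G k) \<longleftrightarrow>
        (\<forall>(i, j)\<in>B. (True, i, j) \<in> pattern G {..<m} x \<or>
          (False, i, j) \<in> pattern G {..<m} x \<and> b i \<noteq> b j)"
    proof (intro ball_cong refl, clarify)
      fix i j assume "(i, j) \<in> B"
      then show "(pr b x i, pr b x j) \<in> lex_arcs G k \<longleftrightarrow> (True, i, j) \<in> pattern G {..<m} x \<or>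
          (False, i, j) \<in> pattern G {..<m} x \<and> b i \<noteq> b j"
        using Bm[of i j] V[of i] V[of j] pat[of i j] by (simp add: lex_arcs_def pr_def)
    qed
    ultimately show ?thesis by (simp add: P_def Q_def W_def)
  qed
  have "bij_betw (\<lambda>(b, x). pr b x) (?b \<times> ?x) ?y"
    unfolding pr_def by (rule bij_betw_PiE_Times)
  then have "bij_betw (\<lambda>(b, x). pr b x) {z \<in> ?b \<times> ?x. case z of (b, x) \<Rightarrow> P b x} {y \<in> ?y. Q y}"
  proof (rule bij_betw_Collect_transfer)
    fix z assume "z \<in> ?b \<times> ?x"
    then obtain b x where "z = (b, x)" "b \<in> ?b" "x \<in> ?x" by (elim SigmaE)
    then show "(case z of (b, x) \<Rightarrow> P b x) \<longleftrightarrow> Q (case z of (b, x) \<Rightarrow> pr b x)"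
      by (simp only: prod.case PQ)
  qed
  then have "card {y \<in> ?y. Q y} = card {z \<in> ?b \<times> ?x. case z of (b, x) \<Rightarrow> P b x}"
    by (rule bij_betw_same_card[symmetric])
  also have "of_nat \<dots> = (\<Sum>z\<in>?b \<times> ?x. if (case z of (b, x) \<Rightarrow> P b x) then 1 else 0 :: rat)"
    by (simp only: sum.inter_filter[symmetric] finite_cartesian_product fin sum_constant mult_1_right)
  also have "\<dots> = (\<Sum>(b, x)\<in>?b \<times> ?x. W b (pattern G {..<m} x))"
    by (rule sum.cong[OF refl], clarify)
      (simp only: prod.case P_def W_def if_cancel split: if_splits, simp)
  also have "\<dots> = (\<Sum>b\<in>?b. \<Sum>x\<in>?x. W b (pattern G {..<m} x))"
    by (rule sum.cartesian_product[symmetric])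
  finally show ?thesis by (simp add: Q_def)
qed

text \<open>The summation ranges of \<open>m\<close>, \<open>B\<close> and \<open>b\<close> do not
  vary with \<open>q\<close>, so polynomiality of each pattern sum carries over to the
  coefficient.\<close>

lemma polynomial_seq_top_coeff_lex:
  assumes G: "strongly_polynomial G"
  shows "polynomial_seq (\<lambda>q. top_coeff (chrom (pverts (G q) \<times> {..<k}) (lex_arcs (G q) k)) r)"
proof -
  have graph: "pair_graph (G q)" for q
    using G by (simp add: strongly_polynomial_def)
  have fin: "finite (pverts (G q) \<times> {..<k})" for q
    using pair_fin_digraph.pair_finite_verts[of "G q"] graph[of q]
    by (auto simp: pair_graph_def pair_digraph_def)
  have poly: "polynomial_seq (\<lambda>q. of_nat (card {y \<in> {..<m} \<rightarrow>\<^sub>E pverts (G q) \<times> {..<k}.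
      inj_on y {..<m} \<and> map_prod y y ` B \<subseteq> lex_arcs (G q) k}))"
    if "B \<subseteq> {..<m} \<times> {..<m}" for B and m :: nat
    unfolding card_lex_embeddings[OF graph that]
    by (intro polynomial_seq_sum polynomial_seq_sum_pattern[OF G]) simp
  show ?thesis
    unfolding top_coeff_chrom_enumeration[OF lex_arcs_subset fin irrefl_lex_arcs[OF graph]]
    by (intro polynomial_seq_sum polynomial_seq_cmult poly) blast
qed

section \<open>Integrality of rational polynomials at integer points\<close>

lemma poly_periodic_mod_Ints:
  fixes p :: "rat poly"
  shows "\<exists>D>0. (\<forall>z. of_int D * poly p (of_int z) \<in> \<int>) \<and>
    (\<forall>z t. poly p (of_int (z + D * t)) - poly p (of_int z) \<in> \<int>)"
proof (induction p)
  case 0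
  show ?case by (intro exI[of _ 1]) auto
next
  case (pCons a p)
  then obtain D where D: "D > 0" "\<And>z. of_int D * poly p (of_int z) \<in> \<int>"
    "\<And>z t. poly p (of_int (z + D * t)) - poly p (of_int z) \<in> \<int>" by blast
  obtain c d where "quotient_of a = (c, d)" by (cases "quotient_of a") auto
  then have d: "d > 0" "of_int d * a \<in> \<int>"
    using quotient_of_denom_pos quotient_of_div[of a c d] by auto
  \<comment> \<open>\<open>D\<close> works for \<open>p\<close> and \<open>d\<close> is the
    denominator of \<open>a\<close>. The increment of \<open>z * p(z)\<close> over the shift is
    \<open>z\<close> times an increment of \<open>p\<close> plus a multiple of
    \<open>D * p(w)\<close>; integrality of the latter is why the first conjunct is carried through
    the induction.\<close>
  show ?case
  proof (intro exI[of _ "D * d"] conjI allI)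
    show "D * d > 0" using D d by simp
    fix z
    have "of_int (D * d) * poly (pCons a p) (of_int z)
        = of_int D * (of_int d * a) + of_int (d * z) * (of_int D * poly p (of_int z))"
      by (simp add: algebra_simps)
    then show "of_int (D * d) * poly (pCons a p) (of_int z) \<in> \<int>"
      using D d by (simp del: of_int_mult)
    fix t
    let ?w = "z + D * d * t"
    have "poly (pCons a p) (of_int ?w) - poly (pCons a p) (of_int z)
        = of_int z * (poly p (of_int (z + D * (d * t))) - poly p (of_int z))
          + of_int (d * t) * (of_int D * poly p (of_int ?w))"
      by (simp add: algebra_simps)
    then show "poly (pCons a p) (of_int ?w) - poly (pCons a p) (of_int z) \<in> \<int>"
      using D by (simp del: of_int_mult of_int_add)
  qed
qed

text \<open>Modulo the integers the values of \<open>p\<close> are periodic, so any integer argument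
  can be shifted by a multiple of the period to a natural number.\<close>

lemma numerical_polynomial_if_nat:
  assumes "\<And>q :: nat. poly p (of_nat q) \<in> \<int>"
  shows "numerical_polynomial p"
  unfolding numerical_polynomial_def
proof
  fix z :: int
  obtain D where D: "D > 0" "\<And>z t. poly p (of_int (z + D * t)) - poly p (of_int z) \<in> \<int>"
    using poly_periodic_mod_Ints[of p] by blast
  have "z + D * \<bar>z\<bar> \<ge> 0"
    using D(1) mult_right_mono[of 1 D "\<bar>z\<bar>"] by linarith
  then have "poly p (of_int (z + D * \<bar>z\<bar>)) \<in> \<int>"
    using assms[of "nat (z + D * \<bar>z\<bar>)"] by simp
  from Ints_diff[OF this D(2)[of z "\<bar>z\<bar>"]] show "poly p (of_int z) \<in> \<int>" by simp
qed

text \<open>Vertices are tuples over a one-element index set, counted with constant weight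
  1.\<close>

lemma polynomial_seq_card_pverts:
  assumes "strongly_polynomial G"
  shows "polynomial_seq (\<lambda>q. of_nat (card (pverts (G q))))"
proof -
  have "card ({0::nat} \<rightarrow>\<^sub>E pverts (G q)) = card (pverts (G q))" for q
    by (simp add: card_PiE)
  then show ?thesis
    using polynomial_seq_sum_pattern[OF assms, of "{0}" "\<lambda>_. 1"] by simp
qed

theorem theorem3p12:
  fixes k :: nat
  assumes "k \<ge> 1"
  shows "two_level_target (\<lambda>n. Kn_bar n k)"
  unfolding two_level_target_def
proof (intro conjI allI impI)
  show "pair_graph (Kn_bar n k)" for n by (rule pair_graph_Kn_bar[OF assms])
  fix G :: "nat \<Rightarrow> nat pair_pre_digraph"
  assume G: "strongly_polynomial G"
  then have graph: "pair_graph (G q)" for q by (simp add: strongly_polynomial_def)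
  let ?V = "\<lambda>q. pverts (G q) \<times> {..<k}"
  define f where "f q = chrom (?V q) (lex_arcs (G q) k)" for q
  have fin: "finite (?V q)" for q
    using pair_fin_digraph.pair_finite_verts[of "G q"] graph[of q]
    by (auto simp: pair_graph_def pair_digraph_def)
  note chrom = lex_arcs_subset[of "G _" k] fin irrefl_lex_arcs[OF graph, of _ k]
  obtain p :: "rat poly" where p: "\<And>q. of_nat (card (pverts (G q))) = poly p (of_nat q)"
    using polynomial_seq_card_pverts[OF G] by (auto simp: polynomial_seq_def)
  define g where "g = smult (of_nat k) p"
  have g: "poly g (of_nat q) = of_nat (card (?V q))" for q
    by (simp add: g_def card_cartesian_product mult.commute flip: p)
  \<comment> \<open>The values of \<open>g\<close> are cardinalities, so the conventions for a
    negative degree never apply.\<close>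
  have S: "nonneg_set g = UNIV" by (simp add: nonneg_set_def g)
  have "\<forall>r. \<exists>p. \<forall>q. top_coeff (f q) r = poly p (of_nat q)"
    using polynomial_seq_top_coeff_lex[OF G] unfolding f_def polynomial_seq_def by blast
  from choice[OF this] obtain \<phi> where \<phi>: "\<And>r q. top_coeff (f q) r = poly (\<phi> r) (of_nat q)"
    by blast
  \<comment> \<open>The leading coefficient is 1.\<close>
  have "f q \<noteq> 0" for q
    using coeff_chrom_card[OF chrom, of q] by (auto simp: f_def)
  moreover have "numerical_polynomial g"
    by (rule numerical_polynomial_if_nat) (simp add: g)
  moreover have "(\<infinity>::ereal) \<in> range ereal_of_enat"
    by (rule image_eqI[of _ _ \<infinity>]) simp_all
  ultimately have "two_level_polynomial g (\<lambda>_. \<infinity>) f"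
    using \<phi> degree_chrom[OF chrom] unfolding two_level_polynomial_def
    by (intro conjI exI[of _ \<phi>]) (simp_all add: S g f_def)
  then have "two_level_polynomial_infinite_depth g f"
    unfolding two_level_polynomial_infinite_depth_def by blast
  moreover have "of_nat (hom (G q) (Kn_bar n k)) = poly (f q) (of_nat n)" for q n
    using poly_chrom[OF lex_arcs_subset fin, of "{1..n}"] hom_Kn_bar[OF graph] by (simp add: f_def)
  ultimately show "\<exists>g f. two_level_polynomial_infinite_depth g f \<and>
      (\<forall>q n. of_nat (hom (G q) (Kn_bar n k)) = poly (f q) (of_nat n))"
    by blast
qed

end
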